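(* Let $\Sigma$ be an alphabet and let $D=(D,+,\mathrm{Val}^\omega,\diamond,0,1)$ be a commutative cc-$\omega$-valuation semiring. Then for any formula $\varphi\in\mathit{MSO}(D,\mathit{NW}(\Sigma))$ there exists a formula $\varphi'\in\mathit{MSO}(D,\mathit{NW}(\Sigma))$ in which conjunctions occur only between boolean formulas and constants (that is, for every subformula $\psi\wedge\theta$ of $\varphi'$, each of $\psi$ and $\theta$ is a boolean formula or a constant from $D$) such that $[\![\varphi]\!]=[\![\varphi']\!]$.
   Context: Alphabets are finite; $\mathbb N=\{1,2,\dots\}$. **Nested $\omega$-words.** A matching relation $\nu$ is a subset of $(\{-\infty\}\cup\mathbb N)\times(\mathbb N\cup\{\infty\})$ with: (i) $\nu(i,j)\Rightarrow i<j$; (ii) for all $i\in\mathbb N$, $|\{j:\nu(i,j)\}|\le 1$ and $|\{j:\nu(j,i)\}|\le1$; (iii) $\nu(i,j)\wedge\nu(i',j')\wedge i<i'\Rightarrow j<i'\vee j\ge j'$; (iv) $(-\infty,\infty)\notin\nu$. A nested $\omega$-word over $\Sigma$ is a pair $\mathit{nw}=(a_1a_2\dots,\nu)$ of an $\omega$-word over $\Sigma$ and a matching relation; $\mathit{NW}^\omega(\Sigma)$ is the set of all of them. If $\nu(i,j)$, then $i$ (if in $\mathbb N$) is a call and $j$ (if in $\mathbb N$) is a return. **Weight structures.** A monoid $(D,+,0)$ is complete if it has sums $\sum_I:D^I\to D$ for all index sets $I$ with $\sum_{\emptyset}=0$, $\sum_{i\in\{k\}}d_i=d_k$, $\sum_{i\in\{j,k\}}d_i=d_j+d_k$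 ($j\ne k$), and $\sum_{j\in J}\sum_{i\in I_j}d_i=\sum_{i\in I}d_i$ whenever $I$ is the disjoint union of the $I_j$, $j\in J$. An $\omega$-pv-monoid $(D,+,\mathrm{Val}^\omega,\diamond,0,1)$ is a complete monoid $(D,+,0)$ with a function $\mathrm{Val}^\omega:D^\omega\to D$ such that $\mathrm{Val}^\omega((d_i)_{i\in\mathbb N})=0$ if some $d_i=0$, an element $1\in D$ and an operation $\diamond:D^2\to D$ with $\mathrm{Val}^\omega(1^\omega)=1$, $0\diamond d=d\diamond 0=0$, $1\diamond d=d\diamond1=d$ for all $d$. It is: - commutative (associative) if $\diamond$ is commutative (associative); - left-$+$-distributive if $d\diamond\sum_{i\in I}d_i=\sum_{i\in I}(d\diamond d_i)$ always (any index set $I$); right-$+$-distributive analogously; $+$-distributive if both; - left-$\mathrm{Val}^\omega$-distributive if $d\diamond\mathrm{Val}^\omega((d_i)_i)=\mathrm{Val}^\omega((d\diamond d_i)_i)$ always; - left-multiplicative if $d\diamond\mathrm{Val}^\omega((d_i)_i)=\mathrm{Val}^\omega(d\diamond d_1,d_2,d_3,\dots)$ always; - left-distributive if left-$+$-distributive and, additionally, left-$\mathrm{Val}^\omega$-distributive or left-multiplicative; - conditionally commutative if for all $(d_i),(d'_i)\in D^\omega$ with $d_i\diamond d'_j=d'_j\diamond d_i$ for all $j<i$: $\mathrm{Val}^\omega((d_i)_i)\diamond\mathrm{Val}^\omega((d'_i)_i)=\mathrm{Val}^\omega((d_i\diamond d'_i)_i)$; - a cc-$\omega$-valuation semiring if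 it is associative, $+$-distributive, conditionally commutative and left-distributive. **Logic $\mathit{MSO}(D,\mathit{NW}(\Sigma))$.** Boolean formulas: $\beta::=\mathrm{Lab}_a(x)\mid \mathrm{call}(x)\mid \mathrm{ret}(x)\mid x\le y\mid\nu(x,y)\mid x\in X\mid\neg\beta\mid\beta\wedge\beta\mid\forall x.\beta\mid\forall X.\beta$. Formulas: $\varphi::=d\mid\beta\mid\varphi\vee\varphi\mid\varphi\wedge\varphi\mid\forall x.\varphi\mid\exists x.\varphi\mid\exists X.\varphi$, with $d\in D$, $a\in\Sigma$, $x,y$ first order and $X$ second order variables. **Semantics.** For a finite set $\mathcal V\supseteq\mathrm{free}(\varphi)$ of variables, pairs $(\mathit{nw},\sigma)$, with $\sigma$ assigning positions in $\mathbb N$ to first order and subsets of $\mathbb N$ to second order variables in $\mathcal V$, are encoded as usual as nested $\omega$-words over $\Sigma_{\mathcal V}=\Sigma\times\{0,1\}^{\mathcal V}$ with the same $\nu$; words of $\mathit{NW}^\omega(\Sigma_{\mathcal V})$ that arise from an assignment are called valid. $[\![\varphi]\!]_{\mathcal V}:\mathit{NW}^\omega(\Sigma_{\mathcal V})\to D$ is $0$ on non-valid words, and on valid $(\mathit{nw},\sigma)$: atomic formulas have value $1$ if true (respectively: $a_{\sigma(x)}=a$; $\sigma(x)$ is a call; $\sigma(x)$ is a return; $\sigma(x)\le\sigma(y)$; $\nu(\sigma(x),\sigma(y))$; $\sigma(x)\in\sigma(X)$) and $0$ otherwise; $\neg\beta$ has value $1$ if $\beta$ has value $0$, and $0$ otherwise;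 $[\![d]\!]=d$; $\vee$ is interpreted by $+$ and $\wedge$ by $\diamond$ of the values; $[\![\exists x.\varphi]\!]_{\mathcal V}(\mathit{nw},\sigma)=\sum_{i\in\mathbb N}[\![\varphi]\!]_{\mathcal V\cup\{x\}}(\mathit{nw},\sigma[x\to i])$; $[\![\exists X.\varphi]\!]_{\mathcal V}(\mathit{nw},\sigma)=\sum_{I\subseteq\mathbb N}[\![\varphi]\!]_{\mathcal V\cup\{X\}}(\mathit{nw},\sigma[X\to I])$; $[\![\forall x.\varphi]\!]_{\mathcal V}(\mathit{nw},\sigma)=\mathrm{Val}^\omega(([\![\varphi]\!]_{\mathcal V\cup\{x\}}(\mathit{nw},\sigma[x\to i]))_{i\in\mathbb N})$; $[\![\forall X.\beta]\!]_{\mathcal V}(\mathit{nw},\sigma)=1$ if $[\![\beta]\!]_{\mathcal V\cup\{X\}}(\mathit{nw},\sigma[X\to I])=1$ for all $I\subseteq\mathbb N$, and $0$ otherwise. Put $[\![\varphi]\!]=[\![\varphi]\!]_{\mathrm{free}(\varphi)}$. *)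

theory Defs
  imports "HOL-Library.Extended" "HOL-Library.FuncSet" "HOL-Library.Disjoint_Sets"
begin

section \<open>Nested omega-words\<close>

text \<open>
  Positions are natural numbers starting at 0 instead of 1. The type \<^typ>\<open>nat extended\<close> adds the
  end points \<^term>\<open>Minf\<close> and \<^term>\<open>Pinf\<close>.
\<close>

type_synonym 'l nested_word = "(nat \<Rightarrow> 'l) \<times> (nat extended \<times> nat extended) set"

definition matching_relation :: "(nat extended \<times> nat extended) set \<Rightarrow> bool" where
  "matching_relation \<nu> \<longleftrightarrow>
     \<nu> \<subseteq> ({Minf} \<union> range Fin) \<times> (range Fin \<union> {Pinf}) \<and>
     (\<forall>i j. (i, j) \<in> \<nu> \<longrightarrow> i < j) \<and>
     (\<forall>i. (\<exists>\<^sub>\<le>\<^sub>1j. (Fin i, j) \<in> \<nu>) \<and> (\<exists>\<^sub>\<le>\<^sub>1j. (j, Fin i) \<in> \<nu>)) \<and>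
     (\<forall>i j i' j'. (i, j) \<in> \<nu> \<and> (i', j') \<in> \<nu> \<and> i < i' \<longrightarrow> j < i' \<or> j \<ge> j') \<and>
     (Minf, Pinf) \<notin> \<nu>"

definition nested_words :: "'l set \<Rightarrow> 'l nested_word set" where
  "nested_words L = {(u, \<nu>). range u \<subseteq> L \<and> matching_relation \<nu>}"

definition is_call :: "(nat extended \<times> nat extended) set \<Rightarrow> nat \<Rightarrow> bool" where
  "is_call \<nu> i \<longleftrightarrow> (\<exists>j. (Fin i, j) \<in> \<nu>)"

definition is_return :: "(nat extended \<times> nat extended) set \<Rightarrow> nat \<Rightarrow> bool" where
  "is_return \<nu> j \<longleftrightarrow> (\<exists>i. (i, Fin j) \<in> \<nu>)"


section \<open>Weight structures\<close>

text \<open>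
  Index sets are subsets of the type \<^typ>\<open>'i\<close>. Since HOL cannot quantify over all types inside a
  structure, \<^typ>\<open>'i\<close> is a parameter; results about all types \<^typ>\<open>'i\<close> cover all index sets.
\<close>

record ('d, 'i) weight_structure =
  add :: "'d \<Rightarrow> 'd \<Rightarrow> 'd" (infixl "\<oplus>\<index>" 65)
  zero :: 'd ("\<zero>\<index>")
  isum :: "'i set \<Rightarrow> ('i \<Rightarrow> 'd) \<Rightarrow> 'd"
  Val :: "(nat \<Rightarrow> 'd) \<Rightarrow> 'd"
  dia :: "'d \<Rightarrow> 'd \<Rightarrow> 'd" (infixl "\<diamondop>\<index>" 70)
  one :: 'd ("\<one>\<index>")

text \<open>
  A family over an index set \<open>I\<close> is given by a total function; \<open>isum_cong\<close> says that only its
  values on \<open>I\<close> matter.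
\<close>

locale complete_monoid =
  fixes D :: "('d, 'i) weight_structure" (structure)
  assumes monoid: "monoid (add D) \<zero>"
    and isum_cong: "(\<And>i. i \<in> I \<Longrightarrow> d i = d' i) \<Longrightarrow> isum D I d = isum D I d'"
    and isum_empty: "isum D {} d = \<zero>"
    and isum_singleton: "isum D {k} d = d k"
    and isum_pair: "j \<noteq> k \<Longrightarrow> isum D {j, k} d = d j \<oplus> d k"
    and isum_partition: "disjoint_family_on A J \<Longrightarrow>
      isum D J (\<lambda>j. isum D (A j) d) = isum D (\<Union>j\<in>J. A j) d"

locale omega_pv_monoid = complete_monoid +
  assumes Val_zero: "ds i = \<zero> \<Longrightarrow> Val D ds = \<zero>"
    and Val_one: "Val D (\<lambda>_. \<one>) = \<one>"
    and zero_dia: "\<zero> \<diamondop> d = \<zero>"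
    and dia_zero: "d \<diamondop> \<zero> = \<zero>"
    and one_dia: "\<one> \<diamondop> d = d"
    and dia_one: "d \<diamondop> \<one> = d"

definition commutative :: "('d, 'i) weight_structure \<Rightarrow> bool" where
  "commutative D \<longleftrightarrow> (\<forall>d e. d \<diamondop>\<^bsub>D\<^esub> e = e \<diamondop>\<^bsub>D\<^esub> d)"

definition associative :: "('d, 'i) weight_structure \<Rightarrow> bool" where
  "associative D \<longleftrightarrow> (\<forall>d e f. (d \<diamondop>\<^bsub>D\<^esub> e) \<diamondop>\<^bsub>D\<^esub> f = d \<diamondop>\<^bsub>D\<^esub> (e \<diamondop>\<^bsub>D\<^esub> f))"

definition left_plus_distributive :: "('d, 'i) weight_structure \<Rightarrow> bool" where
  "left_plus_distributive D \<longleftrightarrow>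
     (\<forall>d I ds. d \<diamondop>\<^bsub>D\<^esub> isum D I ds = isum D I (\<lambda>i. d \<diamondop>\<^bsub>D\<^esub> ds i))"

definition right_plus_distributive :: "('d, 'i) weight_structure \<Rightarrow> bool" where
  "right_plus_distributive D \<longleftrightarrow>
     (\<forall>d I ds. isum D I ds \<diamondop>\<^bsub>D\<^esub> d = isum D I (\<lambda>i. ds i \<diamondop>\<^bsub>D\<^esub> d))"

definition plus_distributive :: "('d, 'i) weight_structure \<Rightarrow> bool" where
  "plus_distributive D \<longleftrightarrow> left_plus_distributive D \<and> right_plus_distributive D"

definition left_Val_distributive :: "('d, 'i) weight_structure \<Rightarrow> bool" where
  "left_Val_distributive D \<longleftrightarrow>
     (\<forall>d ds. d \<diamondop>\<^bsub>D\<^esub> Val D ds = Val D (\<lambda>i. d \<diamondop>\<^bsub>D\<^esub> ds i))"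

definition left_multiplicative :: "('d, 'i) weight_structure \<Rightarrow> bool" where
  "left_multiplicative D \<longleftrightarrow>
     (\<forall>d ds. d \<diamondop>\<^bsub>D\<^esub> Val D ds = Val D (ds(0 := d \<diamondop>\<^bsub>D\<^esub> ds 0)))"

definition left_distributive :: "('d, 'i) weight_structure \<Rightarrow> bool" where
  "left_distributive D \<longleftrightarrow>
     left_plus_distributive D \<and> (left_Val_distributive D \<or> left_multiplicative D)"

definition conditionally_commutative :: "('d, 'i) weight_structure \<Rightarrow> bool" where
  "conditionally_commutative D \<longleftrightarrow>
     (\<forall>ds es. (\<forall>i j. j < i \<longrightarrow> ds i \<diamondop>\<^bsub>D\<^esub> es j = es j \<diamondop>\<^bsub>D\<^esub> ds i) \<longrightarrow>
        Val D ds \<diamondop>\<^bsub>D\<^esub> Val D es = Val D (\<lambda>i. ds i \<diamondop>\<^bsub>D\<^esub> es i))"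

definition cc_omega_valuation_semiring :: "('d, 'i) weight_structure \<Rightarrow> bool" where
  "cc_omega_valuation_semiring D \<longleftrightarrow>
     omega_pv_monoid D \<and> associative D \<and> plus_distributive D \<and>
     conditionally_commutative D \<and> left_distributive D"

text \<open>
  The semantics needs sums over positions and over sets of positions. The following index type
  contains both and, by its last component, an arbitrary further type.
\<close>

datatype 'i index = Pos (pos: nat) | Poss (poss: "nat set") | Other 'i

definition sum_positions :: "('d, 'i index) weight_structure \<Rightarrow> (nat \<Rightarrow> 'd) \<Rightarrow> 'd" where
  "sum_positions D f = isum D (range Pos) (\<lambda>k. f (pos k))"

definition sum_position_sets :: "('d, 'i index) weight_structure \<Rightarrow> (nat set \<Rightarrow> 'd) \<Rightarrow> 'd" where
  "sum_position_sets D f = isum D (range Poss) (\<lambda>k. f (poss k))"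


section \<open>Syntax\<close>

text \<open>
  First and second order variables are two disjoint copies of \<^typ>\<open>nat\<close>. The datatype is a common
  raw syntax for both levels of the grammar, so a boolean formula is itself a formula.
\<close>

datatype var = FO nat | SO nat

datatype ('d, 'a) mso =
    Const 'd
  | Lab 'a nat
  | Call nat
  | Ret nat
  | Le nat nat
  | Match nat nat
  | Mem nat nat
  | Neg "('d, 'a) mso"
  | Or "('d, 'a) mso" "('d, 'a) mso"
  | And "('d, 'a) mso" "('d, 'a) mso"
  | AllFO nat "('d, 'a) mso"
  | AllSO nat "('d, 'a) mso"
  | ExFO nat "('d, 'a) mso"
  | ExSO nat "('d, 'a) mso"

inductive boolean_formula :: "('d, 'a) mso \<Rightarrow> bool" where
  "boolean_formula (Lab a x)"
| "boolean_formula (Call x)"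
| "boolean_formula (Ret x)"
| "boolean_formula (Le x y)"
| "boolean_formula (Match x y)"
| "boolean_formula (Mem x X)"
| "boolean_formula \<beta> \<Longrightarrow> boolean_formula (Neg \<beta>)"
| "boolean_formula \<beta> \<Longrightarrow> boolean_formula \<gamma> \<Longrightarrow> boolean_formula (And \<beta> \<gamma>)"
| "boolean_formula \<beta> \<Longrightarrow> boolean_formula (AllFO x \<beta>)"
| "boolean_formula \<beta> \<Longrightarrow> boolean_formula (AllSO X \<beta>)"

inductive mso_formula :: "('d, 'a) mso \<Rightarrow> bool" where
  "mso_formula (Const d)"
| "boolean_formula \<beta> \<Longrightarrow> mso_formula \<beta>"
| "mso_formula \<phi> \<Longrightarrow> mso_formula \<psi> \<Longrightarrow> mso_formula (Or \<phi> \<psi>)"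
| "mso_formula \<phi> \<Longrightarrow> mso_formula \<psi> \<Longrightarrow> mso_formula (And \<phi> \<psi>)"
| "mso_formula \<phi> \<Longrightarrow> mso_formula (AllFO x \<phi>)"
| "mso_formula \<phi> \<Longrightarrow> mso_formula (ExFO x \<phi>)"
| "mso_formula \<phi> \<Longrightarrow> mso_formula (ExSO X \<phi>)"

primrec free :: "('d, 'a) mso \<Rightarrow> var set" where
  "free (Const d) = {}"
| "free (Lab a x) = {FO x}"
| "free (Call x) = {FO x}"
| "free (Ret x) = {FO x}"
| "free (Le x y) = {FO x, FO y}"
| "free (Match x y) = {FO x, FO y}"
| "free (Mem x X) = {FO x, SO X}"
| "free (Neg \<phi>) = free \<phi>"
| "free (Or \<phi> \<psi>) = free \<phi> \<union> free \<psi>"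
| "free (And \<phi> \<psi>) = free \<phi> \<union> free \<psi>"
| "free (AllFO x \<phi>) = free \<phi> - {FO x}"
| "free (AllSO X \<phi>) = free \<phi> - {SO X}"
| "free (ExFO x \<phi>) = free \<phi> - {FO x}"
| "free (ExSO X \<phi>) = free \<phi> - {SO X}"

primrec subformulas :: "('d, 'a) mso \<Rightarrow> ('d, 'a) mso set" where
  "subformulas (Const d) = {Const d}"
| "subformulas (Lab a x) = {Lab a x}"
| "subformulas (Call x) = {Call x}"
| "subformulas (Ret x) = {Ret x}"
| "subformulas (Le x y) = {Le x y}"
| "subformulas (Match x y) = {Match x y}"
| "subformulas (Mem x X) = {Mem x X}"
| "subformulas (Neg \<phi>) = insert (Neg \<phi>) (subformulas \<phi>)"
| "subformulas (Or \<phi> \<psi>) = insert (Or \<phi> \<psi>) (subformulas \<phi> \<union> subformulas \<psi>)"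
| "subformulas (And \<phi> \<psi>) = insert (And \<phi> \<psi>) (subformulas \<phi> \<union> subformulas \<psi>)"
| "subformulas (AllFO x \<phi>) = insert (AllFO x \<phi>) (subformulas \<phi>)"
| "subformulas (AllSO X \<phi>) = insert (AllSO X \<phi>) (subformulas \<phi>)"
| "subformulas (ExFO x \<phi>) = insert (ExFO x \<phi>) (subformulas \<phi>)"
| "subformulas (ExSO X \<phi>) = insert (ExSO X \<phi>) (subformulas \<phi>)"

definition boolean_or_constant :: "('d, 'a) mso \<Rightarrow> bool" where
  "boolean_or_constant \<phi> \<longleftrightarrow> boolean_formula \<phi> \<or> (\<exists>d. \<phi> = Const d)"

definition conjunctions_restricted :: "('d, 'a) mso \<Rightarrow> bool" where
  "conjunctions_restricted \<phi> \<longleftrightarrow>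
     (\<forall>\<psi> \<theta>. And \<psi> \<theta> \<in> subformulas \<phi> \<longrightarrow> boolean_or_constant \<psi> \<and> boolean_or_constant \<theta>)"


section \<open>Semantics\<close>

text \<open>
  The semantics on a pair of a nested word and an assignment; \<open>s\<close> and \<open>S\<close> interpret the first and
  the second order variables.
\<close>

primrec value_at :: "('d, 'i index) weight_structure \<Rightarrow> 'a nested_word \<Rightarrow> ('d, 'a) mso \<Rightarrow>
    (nat \<Rightarrow> nat) \<Rightarrow> (nat \<Rightarrow> nat set) \<Rightarrow> 'd" where
  "value_at D nw (Const d) s S = d"
| "value_at D nw (Lab a x) s S = (if fst nw (s x) = a then \<one>\<^bsub>D\<^esub> else \<zero>\<^bsub>D\<^esub>)"
| "value_at D nw (Call x) s S = (if is_call (snd nw) (s x) then \<one>\<^bsub>D\<^esub> else \<zero>\<^bsub>D\<^esub>)"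
| "value_at D nw (Ret x) s S = (if is_return (snd nw) (s x) then \<one>\<^bsub>D\<^esub> else \<zero>\<^bsub>D\<^esub>)"
| "value_at D nw (Le x y) s S = (if s x \<le> s y then \<one>\<^bsub>D\<^esub> else \<zero>\<^bsub>D\<^esub>)"
| "value_at D nw (Match x y) s S = (if (Fin (s x), Fin (s y)) \<in> snd nw then \<one>\<^bsub>D\<^esub> else \<zero>\<^bsub>D\<^esub>)"
| "value_at D nw (Mem x X) s S = (if s x \<in> S X then \<one>\<^bsub>D\<^esub> else \<zero>\<^bsub>D\<^esub>)"
| "value_at D nw (Neg \<phi>) s S = (if value_at D nw \<phi> s S = \<zero>\<^bsub>D\<^esub> then \<one>\<^bsub>D\<^esub> else \<zero>\<^bsub>D\<^esub>)"
| "value_at D nw (Or \<phi> \<psi>) s S = value_at D nw \<phi> s S \<oplus>\<^bsub>D\<^esub> value_at D nw \<psi> s S"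
| "value_at D nw (And \<phi> \<psi>) s S = value_at D nw \<phi> s S \<diamondop>\<^bsub>D\<^esub> value_at D nw \<psi> s S"
| "value_at D nw (AllFO x \<phi>) s S = Val D (\<lambda>i. value_at D nw \<phi> (s(x := i)) S)"
| "value_at D nw (AllSO X \<phi>) s S =
     (if \<forall>I. value_at D nw \<phi> s (S(X := I)) = \<one>\<^bsub>D\<^esub> then \<one>\<^bsub>D\<^esub> else \<zero>\<^bsub>D\<^esub>)"
| "value_at D nw (ExFO x \<phi>) s S = sum_positions D (\<lambda>i. value_at D nw \<phi> (s(x := i)) S)"
| "value_at D nw (ExSO X \<phi>) s S = sum_position_sets D (\<lambda>I. value_at D nw \<phi> s (S(X := I)))"

definition extended_alphabet :: "var set \<Rightarrow> ('a \<times> (var \<Rightarrow> bool)) set" where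
  "extended_alphabet V = UNIV \<times> (V \<rightarrow>\<^sub>E UNIV)"

definition encode :: "var set \<Rightarrow> 'a nested_word \<Rightarrow> (nat \<Rightarrow> nat) \<Rightarrow> (nat \<Rightarrow> nat set) \<Rightarrow>
    ('a \<times> (var \<Rightarrow> bool)) nested_word" where
  "encode V nw s S =
     (\<lambda>i. (fst nw i, \<lambda>v\<in>V. case v of FO x \<Rightarrow> s x = i | SO X \<Rightarrow> i \<in> S X), snd nw)"

definition valid_words :: "var set \<Rightarrow> ('a \<times> (var \<Rightarrow> bool)) nested_word set" where
  "valid_words V = {encode V nw s S | nw s S. nw \<in> nested_words UNIV}"

definition word_of :: "('a \<times> (var \<Rightarrow> bool)) nested_word \<Rightarrow> 'a nested_word" where
  "word_of w = (\<lambda>i. fst (fst w i), snd w)"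

definition fo_of :: "('a \<times> (var \<Rightarrow> bool)) nested_word \<Rightarrow> nat \<Rightarrow> nat" where
  "fo_of w x = (THE i. snd (fst w i) (FO x))"

definition so_of :: "('a \<times> (var \<Rightarrow> bool)) nested_word \<Rightarrow> nat \<Rightarrow> nat set" where
  "so_of w X = {i. snd (fst w i) (SO X)}"

definition semantics_wrt :: "('d, 'i index) weight_structure \<Rightarrow> var set \<Rightarrow> ('d, 'a) mso \<Rightarrow>
    ('a \<times> (var \<Rightarrow> bool)) nested_word \<Rightarrow> 'd" where
  "semantics_wrt D V \<phi> w =
     (if w \<in> valid_words V then value_at D (word_of w) \<phi> (fo_of w) (so_of w) else \<zero>\<^bsub>D\<^esub>)"

definition semantics :: "('d, 'i index) weight_structure \<Rightarrow> ('d, 'a) mso \<Rightarrow>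
    ('a \<times> (var \<Rightarrow> bool)) nested_word \<Rightarrow> 'd" where
  "semantics D \<phi> = semantics_wrt D (free \<phi>) \<phi>"

text \<open>
  The functions denoted by two formulas are equal if they have the same domain, the nested words
  over the alphabet extended by the free variables, and the same values there.
\<close>

definition same_semantics ::
    "('d, 'i index) weight_structure \<Rightarrow> ('d, 'a) mso \<Rightarrow> ('d, 'a) mso \<Rightarrow> bool" where
  "same_semantics D \<phi> \<psi> \<longleftrightarrow>
     free \<phi> = free \<psi> \<and>
     (\<forall>w \<in> nested_words (extended_alphabet (free \<phi>)). semantics D \<phi> w = semantics D \<psi> w)"

lemma value_at_cong:
  assumes "\<And>x. FO x \<in> free \<phi> \<Longrightarrow> s x = s' x"
    and "\<And>X. SO X \<in> free \<phi> \<Longrightarrow> S X = S' X"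
  shows "value_at D nw \<phi> s S = value_at D nw \<phi> s' S'"
  using assms
proof (induction \<phi> arbitrary: s s' S S')
  case (Neg \<phi>)
  have "value_at D nw \<phi> s S = value_at D nw \<phi> s' S'"
    by (rule Neg.IH) (use Neg.prems in auto)
  then show ?case by simp
next
  case (Or \<phi> \<psi>)
  have "value_at D nw \<phi> s S = value_at D nw \<phi> s' S'"
    by (rule Or.IH) (use Or.prems in auto)
  moreover have "value_at D nw \<psi> s S = value_at D nw \<psi> s' S'"
    by (rule Or.IH) (use Or.prems in auto)
  ultimately show ?case by simp
next
  case (And \<phi> \<psi>)
  have "value_at D nw \<phi> s S = value_at D nw \<phi> s' S'"
    by (rule And.IH) (use And.prems in auto)
  moreover have "value_at D nw \<psi> s S = value_at D nw \<psi> s' S'"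
    by (rule And.IH) (use And.prems in auto)
  ultimately show ?case by simp
next
  case (AllFO x \<phi>)
  have "value_at D nw \<phi> (s(x := i)) S = value_at D nw \<phi> (s'(x := i)) S'" for i
    by (rule AllFO.IH) (use AllFO.prems in auto)
  then show ?case by simp
next
  case (AllSO X \<phi>)
  have "value_at D nw \<phi> s (S(X := I)) = value_at D nw \<phi> s' (S'(X := I))" for I
    by (rule AllSO.IH) (use AllSO.prems in auto)
  then show ?case by simp
next
  case (ExFO x \<phi>)
  have "value_at D nw \<phi> (s(x := i)) S = value_at D nw \<phi> (s'(x := i)) S'" for i
    by (rule ExFO.IH) (use ExFO.prems in auto)
  then show ?case by simp
next
  case (ExSO X \<phi>)
  have "value_at D nw \<phi> s (S(X := I)) = value_at D nw \<phi> s' (S'(X := I))" for I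
    by (rule ExSO.IH) (use ExSO.prems in auto)
  then show ?case by simp
qed simp_all

text \<open>On encoded pairs the semantics is the intended one.\<close>

lemma semantics_wrt_encode:
  assumes "nw \<in> nested_words UNIV" "free \<phi> \<subseteq> V"
  shows "semantics_wrt D V \<phi> (encode V nw s S) = value_at D nw \<phi> s S"
proof -
  have "value_at D nw \<phi> (fo_of (encode V nw s S)) (so_of (encode V nw s S)) = value_at D nw \<phi> s S"
    by (rule value_at_cong) (use assms(2) in \<open>auto simp: fo_of_def so_of_def encode_def subset_iff\<close>)
  moreover have "word_of (encode V nw s S) = nw"
    by (simp add: word_of_def encode_def)
  moreover have "encode V nw s S \<in> valid_words V"
    using assms(1) unfolding valid_words_def by blast
  ultimately show ?thesis by (simp add: semantics_wrt_def)
qed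

lemma valid_words_subset: "valid_words V \<subseteq> nested_words (extended_alphabet V)"
  by (auto simp: valid_words_def nested_words_def extended_alphabet_def encode_def)

end

theory Submission
  imports Defs "HOL-Combinatorics.Transposition"
begin

text \<open>
  The product of two restricted formulas is again denoted by a restricted formula: sums and
  existential quantifiers are pulled out by distributivity after renaming bound variables, and two
  universal quantifiers are merged by conditional commutativity, whose hypothesis is void in the
  commutative case. A boolean factor is moved under a universal quantifier because its value is
  \<open>\<zero>\<close> or \<open>\<one>\<close>, and a constant factor by left distributivity, where in the left-multiplicative case
  it is attached to the first position only.
\<close>

section \<open>Formulas whose conjunctions join only boolean formulas and constants\<close>

inductive restricted :: "('d, 'a) mso \<Rightarrow> bool" where
  bool: "boolean_formula \<beta> \<Longrightarrow> restricted \<beta>"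
| const: "restricted (Const d)"
| conj: "boolean_or_constant \<phi> \<Longrightarrow> boolean_or_constant \<psi> \<Longrightarrow> restricted (And \<phi> \<psi>)"
| disj: "restricted \<phi> \<Longrightarrow> restricted \<psi> \<Longrightarrow> restricted (Or \<phi> \<psi>)"
| all: "restricted \<phi> \<Longrightarrow> restricted (AllFO x \<phi>)"
| exFO: "restricted \<phi> \<Longrightarrow> restricted (ExFO x \<phi>)"
| exSO: "restricted \<phi> \<Longrightarrow> restricted (ExSO X \<phi>)"

lemma mso_formula_boolean_or_constant: "boolean_or_constant \<phi> \<Longrightarrow> mso_formula \<phi>"
  by (auto simp: boolean_or_constant_def intro: mso_formula.intros)

lemma restricted_mso_formula: "restricted \<phi> \<Longrightarrow> mso_formula \<phi>"
  by (induction rule: restricted.induct)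
    (auto intro: mso_formula.intros mso_formula_boolean_or_constant)

lemma boolean_conjunctions_restricted: "boolean_formula \<beta> \<Longrightarrow> conjunctions_restricted \<beta>"
  by (induction rule: boolean_formula.induct)
    (auto simp: conjunctions_restricted_def boolean_or_constant_def)

lemma boolean_or_constant_conjunctions_restricted:
  "boolean_or_constant \<phi> \<Longrightarrow> conjunctions_restricted \<phi>"
  using boolean_conjunctions_restricted
  by (auto simp: boolean_or_constant_def conjunctions_restricted_def)

text \<open>The inductive predicate provides an induction principle for the target class; this lemma
  and \<open>restricted_mso_formula\<close> lead back to the two syntactic properties required of
  the result.\<close>

lemma restricted_conjunctions_restricted: "restricted \<phi> \<Longrightarrow> conjunctions_restricted \<phi>"
proof (induction rule: restricted.induct)
  case (conj \<phi> \<psi>)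
  then show ?case
    using boolean_or_constant_conjunctions_restricted[of \<phi>]
      boolean_or_constant_conjunctions_restricted[of \<psi>]
    by (auto simp: conjunctions_restricted_def)
next
  case (bool \<beta>)
  then show ?case by (rule boolean_conjunctions_restricted)
qed (auto simp: conjunctions_restricted_def)

lemma finite_free: "finite (free \<phi>)"
  by (induction \<phi>) auto

section \<open>Renaming variables\<close>

text \<open>Binders are renamed together with free and bound occurrences. For bijective
  \<open>f\<close> and \<open>g\<close> no variable can be captured, so the clauses need no side
  conditions.\<close>

primrec rename :: "(nat \<Rightarrow> nat) \<Rightarrow> (nat \<Rightarrow> nat) \<Rightarrow> ('d, 'a) mso \<Rightarrow> ('d, 'a) mso" where
  "rename f g (Const d) = Const d"
| "rename f g (Lab a x) = Lab a (f x)"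
| "rename f g (Call x) = Call (f x)"
| "rename f g (Ret x) = Ret (f x)"
| "rename f g (Le x y) = Le (f x) (f y)"
| "rename f g (Match x y) = Match (f x) (f y)"
| "rename f g (Mem x X) = Mem (f x) (g X)"
| "rename f g (Neg \<phi>) = Neg (rename f g \<phi>)"
| "rename f g (Or \<phi> \<psi>) = Or (rename f g \<phi>) (rename f g \<psi>)"
| "rename f g (And \<phi> \<psi>) = And (rename f g \<phi>) (rename f g \<psi>)"
| "rename f g (AllFO x \<phi>) = AllFO (f x) (rename f g \<phi>)"
| "rename f g (AllSO X \<phi>) = AllSO (g X) (rename f g \<phi>)"
| "rename f g (ExFO x \<phi>) = ExFO (f x) (rename f g \<phi>)"
| "rename f g (ExSO X \<phi>) = ExSO (g X) (rename f g \<phi>)"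

text \<open>Transpositions and the identity are the only renamings applied. Self-inverse maps cover
  them, and renaming twice then undoes itself.\<close>

definition involution :: "('a \<Rightarrow> 'a) \<Rightarrow> bool" where
  "involution f \<longleftrightarrow> (\<forall>x. f (f x) = x)"

lemma involution_id: "involution id"
  by (simp add: involution_def)

lemma involution_transpose: "involution (transpose x y)"
  by (simp add: involution_def)

text \<open>An involution is injective, so only \<open>x\<close> is sent to the updated point
  \<open>f x\<close>. This is the binder case of \<open>value_at_rename\<close>.\<close>

lemma involution_fun_upd:
  assumes "involution f"
  shows "(s(f x := i)) \<circ> f = (s \<circ> f)(x := i)"
proof -
  have "f y = f x \<longleftrightarrow> y = x" for y
    using assms unfolding involution_def by metis
  then show ?thesis by (simp add: fun_eq_iff)
qed

lemma rename_rename: "involution f \<Longrightarrow> involution g \<Longrightarrow> rename f g (rename f g \<phi>) = \<phi>"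
  by (induction \<phi>) (auto simp: involution_def)

lemma free_rename:
  assumes "involution f" "involution g"
  shows "(FO x \<in> free (rename f g \<phi>) \<longleftrightarrow> FO (f x) \<in> free \<phi>) \<and>
    (SO X \<in> free (rename f g \<phi>) \<longleftrightarrow> SO (g X) \<in> free \<phi>)"
proof -
  have f: "y = f z \<longleftrightarrow> f y = z" "f (f y) = y" for y z
    using assms(1) unfolding involution_def by metis+
  have g: "y = g z \<longleftrightarrow> g y = z" "g (g y) = y" for y z
    using assms(2) unfolding involution_def by metis+
  show ?thesis
    by (induction \<phi>) (auto simp: f g)
qed

lemma value_at_rename:
  assumes "involution f" "involution g"
  shows "value_at D nw (rename f g \<phi>) s S = value_at D nw \<phi> (s \<circ> f) (S \<circ> g)"
  by (induction \<phi> arbitrary: s S) (simp_all add: involution_fun_upd assms)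

lemma boolean_formula_rename: "boolean_formula \<beta> \<Longrightarrow> boolean_formula (rename f g \<beta>)"
  by (induction rule: boolean_formula.induct) (auto intro: boolean_formula.intros)

lemma boolean_or_constant_rename:
  "boolean_or_constant \<phi> \<Longrightarrow> boolean_or_constant (rename f g \<phi>)"
  by (auto simp: boolean_or_constant_def boolean_formula_rename)

lemma restricted_rename: "restricted \<phi> \<Longrightarrow> restricted (rename f g \<phi>)"
  by (induction rule: restricted.induct)
    (auto intro: restricted.intros boolean_formula_rename boolean_or_constant_rename)

abbreviation renameFO :: "nat \<Rightarrow> nat \<Rightarrow> ('d, 'a) mso \<Rightarrow> ('d, 'a) mso" where
  "renameFO x z \<equiv> rename (transpose x z) id"

abbreviation renameSO :: "nat \<Rightarrow> nat \<Rightarrow> ('d, 'a) mso \<Rightarrow> ('d, 'a) mso" where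
  "renameSO X Z \<equiv> rename id (transpose X Z)"

text \<open>After the swap, \<open>x\<close> reads the value stored at \<open>z\<close>, namely
  \<open>i\<close>. The value at \<open>z\<close> may change too, but \<open>z\<close> is not free
  in \<open>\<phi>\<close>.\<close>

lemma value_at_renameFO:
  assumes "FO z \<notin> free \<phi>"
  shows "value_at D nw (renameFO x z \<phi>) (s(z := i)) S = value_at D nw \<phi> (s(x := i)) S"
  unfolding value_at_rename[OF involution_transpose involution_id]
  by (rule value_at_cong) (use assms in \<open>auto simp: transpose_def\<close>)

lemma value_at_renameSO:
  assumes "SO Z \<notin> free \<phi>"
  shows "value_at D nw (renameSO X Z \<phi>) s (S(Z := I)) = value_at D nw \<phi> s (S(X := I))"
  unfolding value_at_rename[OF involution_id involution_transpose]
  by (rule value_at_cong) (use assms in \<open>auto simp: transpose_def\<close>)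

lemma free_renameFO:
  assumes "FO z \<notin> free \<phi>"
  shows "free (renameFO x z \<phi>) - {FO z} \<subseteq> free \<phi> - {FO x}"
proof
  fix v assume "v \<in> free (renameFO x z \<phi>) - {FO z}"
  then show "v \<in> free \<phi> - {FO x}"
    using assms
    by (cases v) (auto simp: free_rename[OF involution_transpose involution_id] transpose_def split: if_splits)
qed

lemma free_renameSO:
  assumes "SO Z \<notin> free \<phi>"
  shows "free (renameSO X Z \<phi>) - {SO Z} \<subseteq> free \<phi> - {SO X}"
proof
  fix v assume "v \<in> free (renameSO X Z \<phi>) - {SO Z}"
  then show "v \<in> free \<phi> - {SO X}"
    using assms
    by (cases v) (auto simp: free_rename[OF involution_id involution_transpose] transpose_def split: if_splits)
qed

lemma fresh_FO:
  assumes "finite V"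
  obtains z where "FO z \<notin> V"
proof -
  have "finite (FO -` V)"
    by (rule finite_vimageI[OF assms]) (simp add: inj_def)
  then show thesis
    using ex_new_if_finite[OF infinite_UNIV_nat] that by blast
qed

lemma fresh_SO:
  assumes "finite V"
  obtains Z where "SO Z \<notin> V"
proof -
  have "finite (SO -` V)"
    by (rule finite_vimageI[OF assms]) (simp add: inj_def)
  then show thesis
    using ex_new_if_finite[OF infinite_UNIV_nat] that by blast
qed

section \<open>Products of restricted formulas\<close>

text \<open>By \<open>dia_commute\<close>, distributivity over sums is needed on one side only. The
  two forms of distributivity over \<open>Val\<close> remain a disjunction, because only a constant
  in front of a universal quantifier requires telling them apart.\<close>

locale commutative_cc_omega_valuation_semiring = omega_pv_monoid D
  for D :: "('d, 'i index) weight_structure" (structure) +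
  assumes dia_commute: "d \<diamondop> e = e \<diamondop> d"
    and dia_assoc: "(d \<diamondop> e) \<diamondop> f = d \<diamondop> (e \<diamondop> f)"
    and dia_isum: "d \<diamondop> isum D I h = isum D I (\<lambda>i. d \<diamondop> h i)"
    and Val_dia_Val: "Val D ds \<diamondop> Val D es = Val D (\<lambda>i. ds i \<diamondop> es i)"
    and Val_distributive_or_multiplicative: "left_Val_distributive D \<or> left_multiplicative D"
begin

text \<open>A binary sum is an indexed sum over two distinct indices; \<open>Pos 0\<close> and
  \<open>Pos 1\<close> serve as such a pair.\<close>

lemma dia_add: "d \<diamondop> (a \<oplus> b) = d \<diamondop> a \<oplus> d \<diamondop> b"
proof -
  let ?f = "\<lambda>k :: 'i index. if k = Pos 0 then a else b"
  have "d \<diamondop> isum D {Pos 0, Pos 1} ?f = isum D {Pos 0, Pos 1} (\<lambda>k. d \<diamondop> ?f k)"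
    by (rule dia_isum)
  then show ?thesis by (simp add: isum_pair)
qed

lemma add_zero: "a \<oplus> \<zero> = a"
  using monoid by (simp add: monoid_def monoid_axioms_def)

lemma zero_add: "\<zero> \<oplus> a = a"
  using monoid by (simp add: monoid_def monoid_axioms_def)

text \<open>In the first order universal case, either some position yields \<open>\<zero>\<close>
  and \<open>Val_zero\<close> applies, or the sequence is constantly \<open>\<one>\<close> and
  \<open>Val_one\<close> applies.\<close>

lemma value_at_boolean: "boolean_formula \<beta> \<Longrightarrow> value_at D nw \<beta> s S \<in> {\<zero>, \<one>}"
proof (induction arbitrary: s S rule: boolean_formula.induct)
  case (8 \<beta> \<gamma>)
  show ?case using 8(3)[of s S] 8(4)[of s S] by (auto simp: zero_dia one_dia)
next
  case (9 \<beta> x)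
  show ?case
  proof (cases "\<exists>i. value_at D nw \<beta> (s(x := i)) S = \<zero>")
    case True
    then show ?thesis using Val_zero by fastforce
  next
    case False
    then have "value_at D nw \<beta> (s(x := i)) S = \<one>" for i
      using 9(2)[of "s(x := i)" S] by blast
    then show ?thesis by (simp add: Val_one)
  qed
qed auto

section \<open>Definable products and their closure under the connectives\<close>

text \<open>An inclusion between the free variables is enough here, since
  \<open>restricted_add_free\<close> later restores equality.\<close>

definition dia_definable :: "('d, 'a) mso \<Rightarrow> ('d, 'a) mso \<Rightarrow> bool" where
  "dia_definable \<phi> \<psi> \<longleftrightarrow> (\<exists>\<chi>. restricted \<chi> \<and> free \<chi> \<subseteq> free \<phi> \<union> free \<psi> \<and>
     (\<forall>nw s S. value_at D nw \<chi> s S = value_at D nw \<phi> s S \<diamondop> value_at D nw \<psi> s S))"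

lemma dia_definableI:
  assumes "restricted \<chi>" "free \<chi> \<subseteq> free \<phi> \<union> free \<psi>"
    "\<And>nw s S. value_at D nw \<chi> s S = value_at D nw \<phi> s S \<diamondop> value_at D nw \<psi> s S"
  shows "dia_definable \<phi> \<psi>"
  using assms unfolding dia_definable_def by blast

lemma dia_definableE:
  assumes "dia_definable \<phi> \<psi>"
  obtains \<chi> where "restricted \<chi>" "free \<chi> \<subseteq> free \<phi> \<union> free \<psi>"
    "\<And>nw s S. value_at D nw \<chi> s S = value_at D nw \<phi> s S \<diamondop> value_at D nw \<psi> s S"
  using assms unfolding dia_definable_def by blast

lemma dia_definable_commute: "dia_definable \<phi> \<psi> \<Longrightarrow> dia_definable \<psi> \<phi>"
  unfolding dia_definable_def using dia_commute by (metis Un_commute)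

lemma dia_definable_rename:
  assumes "dia_definable \<phi> \<psi>" "involution f" "involution g"
  shows "dia_definable (rename f g \<phi>) (rename f g \<psi>)"
proof -
  obtain \<chi> where \<chi>: "restricted \<chi>" "free \<chi> \<subseteq> free \<phi> \<union> free \<psi>"
    "\<And>nw s S. value_at D nw \<chi> s S = value_at D nw \<phi> s S \<diamondop> value_at D nw \<psi> s S"
    using assms(1) by (rule dia_definableE) blast
  show ?thesis
  proof (rule dia_definableI)
    show "restricted (rename f g \<chi>)" using \<chi>(1) by (rule restricted_rename)
    show "free (rename f g \<chi>) \<subseteq> free (rename f g \<phi>) \<union> free (rename f g \<psi>)"
    proof
      fix v assume "v \<in> free (rename f g \<chi>)"
      then show "v \<in> free (rename f g \<phi>) \<union> free (rename f g \<psi>)"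
        using \<chi>(2) by (cases v) (auto simp: free_rename[OF assms(2,3)])
    qed
  qed (simp add: value_at_rename[OF assms(2,3)] \<chi>(3))
qed

lemma dia_definable_Or:
  assumes "dia_definable \<phi> \<psi>" "dia_definable \<phi> \<theta>"
  shows "dia_definable \<phi> (Or \<psi> \<theta>)"
proof -
  obtain \<chi> where \<chi>: "restricted \<chi>" "free \<chi> \<subseteq> free \<phi> \<union> free \<psi>"
    "\<And>nw s S. value_at D nw \<chi> s S = value_at D nw \<phi> s S \<diamondop> value_at D nw \<psi> s S"
    using assms(1) by (rule dia_definableE) blast
  obtain \<chi>' where \<chi>': "restricted \<chi>'" "free \<chi>' \<subseteq> free \<phi> \<union> free \<theta>"
    "\<And>nw s S. value_at D nw \<chi>' s S = value_at D nw \<phi> s S \<diamondop> value_at D nw \<theta> s S"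
    using assms(2) by (rule dia_definableE) blast
  show ?thesis
    by (rule dia_definableI[of "Or \<chi> \<chi>'"])
      (use \<chi> \<chi>' in \<open>auto simp: dia_add intro: restricted.disj\<close>)
qed

text \<open>
  Sets closed under renaming allow to choose the bound variables of one factor apart from the free
  variables of the other one.
\<close>

definition rename_closed :: "('d, 'a) mso set \<Rightarrow> bool" where
  "rename_closed K \<longleftrightarrow> (\<forall>\<phi>\<in>K. \<forall>f g. involution f \<longrightarrow> involution g \<longrightarrow> rename f g \<phi> \<in> K)"

text \<open>The product of \<open>rename f g \<phi>\<close> and \<open>\<psi>\<close> is definable
  because \<open>K\<close> contains the renamed factor. Renaming that product once more turns its
  left factor back into \<open>\<phi>\<close>.\<close>

lemma dia_definable_rename_closed:
  assumes "rename_closed K" "\<And>\<phi>. \<phi> \<in> K \<Longrightarrow> dia_definable \<phi> \<psi>" "\<phi> \<in> K"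
    "involution f" "involution g"
  shows "dia_definable \<phi> (rename f g \<psi>)"
  using assms dia_definable_rename[of "rename f g \<phi>" \<psi> f g]
  by (simp add: rename_closed_def rename_rename)

text \<open>The hypothesis ranges over a whole class \<open>K\<close> of left factors because the
  bound variable has to be renamed in \<open>\<psi>\<close>, which amounts to multiplying
  \<open>\<psi>\<close> by a renamed \<open>\<phi>\<close>.\<close>

lemma dia_definable_ExFO:
  assumes "rename_closed K" "\<And>\<phi>. \<phi> \<in> K \<Longrightarrow> dia_definable \<phi> \<psi>" "\<phi> \<in> K"
  shows "dia_definable \<phi> (ExFO x \<psi>)"
proof -
  obtain z where z: "FO z \<notin> free \<phi> \<union> free \<psi>"
    by (rule fresh_FO[of "free \<phi> \<union> free \<psi>"]) (auto simp: finite_free)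
  have "dia_definable \<phi> (renameFO x z \<psi>)"
    by (rule dia_definable_rename_closed[OF assms involution_transpose involution_id])
  then obtain \<chi> where \<chi>: "restricted \<chi>" "free \<chi> \<subseteq> free \<phi> \<union> free (renameFO x z \<psi>)"
    "\<And>nw s S. value_at D nw \<chi> s S = value_at D nw \<phi> s S \<diamondop> value_at D nw (renameFO x z \<psi>) s S"
    by (rule dia_definableE) blast
  \<comment> \<open>Since \<open>z\<close> is not free in \<open>\<phi>\<close>, the left factor is
    the same in every summand, so \<open>dia_isum\<close> applies.\<close>
  have \<phi>: "value_at D nw \<phi> (s(z := i)) S = value_at D nw \<phi> s S" for nw s i S
    by (rule value_at_cong) (use z in auto)
  show ?thesis
  proof (rule dia_definableI)
    show "restricted (ExFO z \<chi>)" using \<chi>(1) by (rule restricted.exFO)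
    show "free (ExFO z \<chi>) \<subseteq> free \<phi> \<union> free (ExFO x \<psi>)"
      using \<chi>(2) free_renameFO[of z \<psi> x] z by auto
    fix nw :: "'a nested_word" and s S
    show "value_at D nw (ExFO z \<chi>) s S = value_at D nw \<phi> s S \<diamondop> value_at D nw (ExFO x \<psi>) s S"
      using z by (simp add: \<chi>(3) \<phi> value_at_renameFO sum_positions_def dia_isum)
  qed
qed

lemma dia_definable_ExSO:
  assumes "rename_closed K" "\<And>\<phi>. \<phi> \<in> K \<Longrightarrow> dia_definable \<phi> \<psi>" "\<phi> \<in> K"
  shows "dia_definable \<phi> (ExSO X \<psi>)"
proof -
  obtain Z where Z: "SO Z \<notin> free \<phi> \<union> free \<psi>"
    by (rule fresh_SO[of "free \<phi> \<union> free \<psi>"]) (auto simp: finite_free)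
  have "dia_definable \<phi> (renameSO X Z \<psi>)"
    by (rule dia_definable_rename_closed[OF assms involution_id involution_transpose])
  then obtain \<chi> where \<chi>: "restricted \<chi>" "free \<chi> \<subseteq> free \<phi> \<union> free (renameSO X Z \<psi>)"
    "\<And>nw s S. value_at D nw \<chi> s S = value_at D nw \<phi> s S \<diamondop> value_at D nw (renameSO X Z \<psi>) s S"
    by (rule dia_definableE) blast
  have \<phi>: "value_at D nw \<phi> s (S(Z := I)) = value_at D nw \<phi> s S" for nw s I S
    by (rule value_at_cong) (use Z in auto)
  show ?thesis
  proof (rule dia_definableI)
    show "restricted (ExSO Z \<chi>)" using \<chi>(1) by (rule restricted.exSO)
    show "free (ExSO Z \<chi>) \<subseteq> free \<phi> \<union> free (ExSO X \<psi>)"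
      using \<chi>(2) free_renameSO[of Z \<psi> X] Z by auto
    fix nw :: "'a nested_word" and s S
    show "value_at D nw (ExSO Z \<chi>) s S = value_at D nw \<phi> s S \<diamondop> value_at D nw (ExSO X \<psi>) s S"
      using Z by (simp add: \<chi>(3) \<phi> value_at_renameSO sum_position_sets_def dia_isum)
  qed
qed

text \<open>By associativity the factors can be multiplied one after the other. The second product
  starts from whatever restricted formula the first one gave, hence the quantification over
  \<open>\<chi>\<close>.\<close>

lemma dia_definable_And:
  assumes "dia_definable \<phi> \<psi>" "\<And>\<chi>. restricted \<chi> \<Longrightarrow> dia_definable \<chi> \<theta>"
  shows "dia_definable \<phi> (And \<psi> \<theta>)"
proof -
  obtain \<chi> where \<chi>: "restricted \<chi>" "free \<chi> \<subseteq> free \<phi> \<union> free \<psi>"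
    "\<And>nw s S. value_at D nw \<chi> s S = value_at D nw \<phi> s S \<diamondop> value_at D nw \<psi> s S"
    using assms(1) by (rule dia_definableE) blast
  obtain \<chi>' where \<chi>': "restricted \<chi>'" "free \<chi>' \<subseteq> free \<chi> \<union> free \<theta>"
    "\<And>nw s S. value_at D nw \<chi>' s S = value_at D nw \<chi> s S \<diamondop> value_at D nw \<theta> s S"
    using assms(2)[OF \<chi>(1)] by (rule dia_definableE) blast
  show ?thesis
    by (rule dia_definableI[of \<chi>']) (use \<chi> \<chi>' in \<open>auto simp: dia_assoc\<close>)
qed

text \<open>For \<open>\<one>\<close> nothing changes, and for \<open>\<zero>\<close> both sides
  vanish. Hence a boolean factor passes through \<open>Val\<close> under either form of left
  distributivity.\<close>

lemma dia_boolean_Val: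
  assumes "b \<in> {\<zero>, \<one>}"
  shows "b \<diamondop> Val D ds = Val D (\<lambda>i. b \<diamondop> ds i)"
  using assms by (auto simp: zero_dia one_dia Val_zero[of "\<lambda>_. \<zero>"])

section \<open>Products with a boolean factor\<close>

lemma dia_definable_boolean:
  assumes "restricted \<psi>" "boolean_formula \<beta>"
  shows "dia_definable \<beta> \<psi>"
  using assms
proof (induction arbitrary: \<beta> rule: restricted.induct)
  case (bool \<gamma>)
  then show ?case
    by (intro dia_definableI[of "And \<beta> \<gamma>"])
      (auto intro: restricted.bool boolean_formula.intros)
next
  case (const d)
  then show ?case
    by (intro dia_definableI[of "And \<beta> (Const d)"])
      (auto simp: boolean_or_constant_def intro: restricted.conj)
next
  case (conj \<phi> \<psi>)
  \<comment> \<open>Three factors have to fit into one admissible conjunction: boolean factors are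
    collected into a single boolean formula, and constants are multiplied out in
    \<open>D\<close>.\<close>
  have bc: "dia_definable \<beta> (And \<gamma> (Const d))" if "boolean_formula \<gamma>" for \<gamma> d
    using that conj.prems by (intro dia_definableI[of "And (And \<beta> \<gamma>) (Const d)"])
      (auto simp: boolean_or_constant_def dia_assoc intro!: restricted.conj boolean_formula.intros(8))
  have cb: "dia_definable \<beta> (And (Const d) \<gamma>)" if "boolean_formula \<gamma>" for \<gamma> d
    using bc[OF that, of d] unfolding dia_definable_def by (simp add: dia_commute)
  have cc: "dia_definable \<beta> (And (Const d) (Const e))" for d e
    using conj.prems by (intro dia_definableI[of "And \<beta> (Const (d \<diamondop> e))"])
      (auto simp: boolean_or_constant_def intro: restricted.conj)
  have bb: "dia_definable \<beta> (And \<gamma> \<delta>)" if "boolean_formula \<gamma>" "boolean_formula \<delta>" for \<gamma> \<delta>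
    using that conj.prems by (intro dia_definableI[of "And \<beta> (And \<gamma> \<delta>)"])
      (auto intro: restricted.bool boolean_formula.intros)
  show ?case
    using conj.hyps bb bc cb cc unfolding boolean_or_constant_def by metis
next
  case (disj \<phi> \<psi>)
  then show ?case by (blast intro: dia_definable_Or)
next
  case (all \<psi> x)
  obtain z where z: "FO z \<notin> free \<beta> \<union> free \<psi>"
    by (rule fresh_FO[of "free \<beta> \<union> free \<psi>"]) (auto simp: finite_free)
  have "dia_definable \<beta> (renameFO x z \<psi>)"
    by (rule dia_definable_rename_closed[of "Collect boolean_formula"])
      (use all in \<open>auto simp: rename_closed_def boolean_formula_rename
        involution_id involution_transpose\<close>)
  then obtain \<chi> where \<chi>: "restricted \<chi>" "free \<chi> \<subseteq> free \<beta> \<union> free (renameFO x z \<psi>)"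
    "\<And>nw s S. value_at D nw \<chi> s S = value_at D nw \<beta> s S \<diamondop> value_at D nw (renameFO x z \<psi>) s S"
    by (rule dia_definableE) blast
  have \<beta>: "value_at D nw \<beta> (s(z := i)) S = value_at D nw \<beta> s S" for nw s i S
    by (rule value_at_cong) (use z in auto)
  show ?case
  proof (rule dia_definableI)
    show "restricted (AllFO z \<chi>)" using \<chi>(1) by (rule restricted.all)
    show "free (AllFO z \<chi>) \<subseteq> free \<beta> \<union> free (AllFO x \<psi>)"
      using \<chi>(2) free_renameFO[of z \<psi> x] z by auto
    fix nw :: "'a nested_word" and s S
    show "value_at D nw (AllFO z \<chi>) s S = value_at D nw \<beta> s S \<diamondop> value_at D nw (AllFO x \<psi>) s S"
      using z by (simp add: \<chi>(3) \<beta> value_at_renameFO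
          dia_boolean_Val[OF value_at_boolean[OF all.prems]])
  qed
next
  case (exFO \<psi> x)
  show ?case
    by (rule dia_definable_ExFO[of "Collect boolean_formula"])
      (use exFO in \<open>auto simp: rename_closed_def boolean_formula_rename\<close>)
next
  case (exSO \<psi> X)
  show ?case
    by (rule dia_definable_ExSO[of "Collect boolean_formula"])
      (use exSO in \<open>auto simp: rename_closed_def boolean_formula_rename\<close>)
qed

section \<open>Products with a constant factor\<close>

text \<open>The first position is the one below all positions. \<open>Suc x\<close> merely serves as
  a variable different from \<open>x\<close>.\<close>

definition is_first :: "nat \<Rightarrow> ('d, 'a) mso" where
  "is_first x = AllFO (Suc x) (Le x (Suc x))"

lemma boolean_formula_is_first: "boolean_formula (is_first x)"
  by (simp add: is_first_def boolean_formula.intros)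

lemma free_is_first: "free (is_first x) = {FO x}"
  by (auto simp: is_first_def)

lemma value_at_is_first: "value_at D nw (is_first x) s S = (if s x = 0 then \<one> else \<zero>)"
  \<comment> \<open>If \<open>s x\<close> is not 0, the comparison already fails at position 0, and
    this one factor \<open>\<zero>\<close> annihilates \<open>Val\<close>.\<close>
  by (auto simp: is_first_def Val_one intro: Val_zero[of _ 0])

lemma dia_definable_Const_AllFO:
  assumes "restricted \<psi>" "dia_definable (Const d) \<psi>"
  shows "dia_definable (Const d) (AllFO x \<psi>)"
proof -
  obtain \<chi> where \<chi>: "restricted \<chi>" "free \<chi> \<subseteq> free \<psi>"
    "\<And>nw s S. value_at D nw \<chi> s S = d \<diamondop> value_at D nw \<psi> s S"
    using assms(2) by (rule dia_definableE) auto
  show ?thesis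
    using Val_distributive_or_multiplicative
  proof
    assume "left_Val_distributive D"
    then show ?thesis
      using \<chi> by (intro dia_definableI[of "AllFO x \<chi>"])
        (auto simp: left_Val_distributive_def intro: restricted.all)
  next
    assume mult: "left_multiplicative D"
    let ?first = "is_first x :: ('d, 'a) mso"
    \<comment> \<open>\<open>\<alpha>\<close> contributes the value multiplied by \<open>d\<close>
      at the first position, \<open>\<gamma>\<close> the unchanged value at all others. Both guards
      are boolean, so \<open>dia_definable_boolean\<close> makes these products restricted.\<close>
    obtain \<alpha> where \<alpha>: "restricted \<alpha>" "free \<alpha> \<subseteq> free ?first \<union> free \<chi>"
      "\<And>nw s S. value_at D nw \<alpha> s S = value_at D nw ?first s S \<diamondop> value_at D nw \<chi> s S"
      by (rule dia_definableE[OF dia_definable_boolean[OF \<chi>(1) boolean_formula_is_first]]) blast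
    have "boolean_formula (Neg ?first)"
      by (intro boolean_formula.intros boolean_formula_is_first)
    then obtain \<gamma> where \<gamma>: "restricted \<gamma>" "free \<gamma> \<subseteq> free (Neg ?first) \<union> free \<psi>"
      "\<And>nw s S. value_at D nw \<gamma> s S = value_at D nw (Neg ?first) s S \<diamondop> value_at D nw \<psi> s S"
      by (rule dia_definableE[OF dia_definable_boolean[OF assms(1)]]) blast
    \<comment> \<open>If \<open>\<one> = \<zero>\<close>, values do not separate the guard from its
      negation, but then \<open>D\<close> has only one element.\<close>
    have all_zero: "e = \<zero>" if "\<one> = \<zero>" for e
      using one_dia[of e] zero_dia[of e] that by simp
    have val: "value_at D nw (Or \<alpha> \<gamma>) s S =
        (if s x = 0 then d \<diamondop> value_at D nw \<psi> s S else value_at D nw \<psi> s S)" for nw s S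
    proof (cases "\<one> = \<zero>")
      case True
      then show ?thesis using all_zero by metis
    next
      case False
      then show ?thesis
        by (simp add: \<alpha>(3) \<gamma>(3) \<chi>(3) value_at_is_first one_dia zero_dia add_zero zero_add)
    qed
    show ?thesis
    proof (rule dia_definableI)
      show "restricted (AllFO x (Or \<alpha> \<gamma>))"
        using \<alpha>(1) \<gamma>(1) by (intro restricted.all restricted.disj)
      show "free (AllFO x (Or \<alpha> \<gamma>)) \<subseteq> free (Const d) \<union> free (AllFO x \<psi>)"
        using \<alpha>(2) \<gamma>(2) \<chi>(2) by (auto simp: free_is_first)
      fix nw :: "'a nested_word" and s S
      define ds where "ds = (\<lambda>i. value_at D nw \<psi> (s(x := i)) S)"
      have "value_at D nw (Or \<alpha> \<gamma>) (s(x := i)) S = (ds(0 := d \<diamondop> ds 0)) i" for i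
        by (subst val) (simp add: ds_def)
      then have "value_at D nw (AllFO x (Or \<alpha> \<gamma>)) s S = Val D (ds(0 := d \<diamondop> ds 0))"
        by (simp only: value_at.simps(11))
      also have "\<dots> = d \<diamondop> Val D ds"
        using mult by (simp add: left_multiplicative_def)
      finally show "value_at D nw (AllFO x (Or \<alpha> \<gamma>)) s S =
          value_at D nw (Const d) s S \<diamondop> value_at D nw (AllFO x \<psi>) s S"
        by (simp only: value_at.simps(1) value_at.simps(11) ds_def)
    qed
  qed
qed

text \<open>Renaming fixes a constant, so \<open>{Const d}\<close> is a rename-closed class and the
  induction can keep \<open>d\<close> fixed.\<close>

lemma dia_definable_Const: "restricted \<psi> \<Longrightarrow> dia_definable (Const d) \<psi>"
proof (induction rule: restricted.induct)
  case (bool \<beta>)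
  then show ?case
    by (intro dia_definable_commute[OF dia_definable_boolean]) (rule restricted.const)
next
  case (const e)
  then show ?case
    by (intro dia_definableI[of "Const (d \<diamondop> e)"]) (auto intro: restricted.const)
next
  case (conj \<phi> \<psi>)
  have cc: "dia_definable (Const d) (And (Const e) (Const f))" for e f
    by (intro dia_definableI[of "Const (d \<diamondop> (e \<diamondop> f))"]) (auto intro: restricted.const)
  have cb: "dia_definable (Const d) (And (Const e) \<gamma>)" if "boolean_formula \<gamma>" for e \<gamma>
    using that by (intro dia_definableI[of "And (Const (d \<diamondop> e)) \<gamma>"])
      (auto simp: boolean_or_constant_def dia_assoc intro: restricted.conj)
  have bc: "dia_definable (Const d) (And \<gamma> (Const e))" if "boolean_formula \<gamma>" for e \<gamma>
    using cb[OF that, of e] unfolding dia_definable_def by (simp add: dia_commute)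
  have bb: "dia_definable (Const d) (And \<gamma> \<delta>)" if "boolean_formula \<gamma>" "boolean_formula \<delta>" for \<gamma> \<delta>
    using that by (intro dia_definable_commute[OF dia_definable_boolean])
      (auto intro: restricted.const boolean_formula.intros)
  show ?case
    using conj.hyps bb bc cb cc unfolding boolean_or_constant_def by metis
next
  case (disj \<phi> \<psi>)
  then show ?case by (blast intro: dia_definable_Or)
next
  case (all \<psi> x)
  then show ?case by (rule dia_definable_Const_AllFO)
next
  case (exFO \<psi> x)
  show ?case
    by (rule dia_definable_ExFO[of "{Const d}"]) (use exFO in \<open>auto simp: rename_closed_def\<close>)
next
  case (exSO \<psi> X)
  show ?case
    by (rule dia_definable_ExSO[of "{Const d}"]) (use exSO in \<open>auto simp: rename_closed_def\<close>)
qed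

lemma dia_definable_boolean_or_constant:
  "boolean_or_constant \<beta> \<Longrightarrow> restricted \<phi> \<Longrightarrow> dia_definable \<phi> \<beta>"
  using dia_definable_commute dia_definable_boolean dia_definable_Const
  unfolding boolean_or_constant_def by metis

section \<open>Products of arbitrary restricted formulas\<close>

text \<open>This names the induction claim about one factor while the other ranges over all
  restricted formulas. It is what must be known about the body of a universal quantifier before a
  second induction runs over the other factor.\<close>

definition absorbing :: "('d, 'a) mso \<Rightarrow> bool" where
  "absorbing \<phi> \<longleftrightarrow> restricted \<phi> \<and> (\<forall>\<psi>. restricted \<psi> \<longrightarrow> dia_definable \<psi> \<phi>)"

lemma rename_closed_restricted: "rename_closed (Collect restricted)"
  by (simp add: rename_closed_def restricted_rename)

lemma absorbing_rename:
  assumes "absorbing \<phi>" "involution f" "involution g"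
  shows "absorbing (rename f g \<phi>)"
  using assms dia_definable_rename_closed[OF rename_closed_restricted, of \<phi> _ f g]
  by (simp add: absorbing_def restricted_rename)

text \<open>Both bound variables are renamed to one fresh \<open>z\<close>, after which
  \<open>Val_dia_Val\<close> merges the quantifiers position by position. The product of the bodies
  is definable because \<open>\<phi>\<close> is absorbing.\<close>

lemma dia_definable_AllFO_AllFO:
  assumes "absorbing \<phi>" "restricted \<psi>"
  shows "dia_definable (AllFO x \<phi>) (AllFO y \<psi>)"
proof -
  obtain z where z: "FO z \<notin> free \<phi> \<union> free \<psi>"
    by (rule fresh_FO[of "free \<phi> \<union> free \<psi>"]) (auto simp: finite_free)
  have "absorbing (renameFO x z \<phi>)"
    using assms(1) involution_transpose involution_id by (rule absorbing_rename)
  then have "dia_definable (renameFO x z \<phi>) (renameFO y z \<psi>)"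
    using assms(2) by (simp add: absorbing_def dia_definable_commute restricted_rename)
  then obtain \<chi> where \<chi>: "restricted \<chi>"
    "free \<chi> \<subseteq> free (renameFO x z \<phi>) \<union> free (renameFO y z \<psi>)"
    "\<And>nw s S. value_at D nw \<chi> s S =
      value_at D nw (renameFO x z \<phi>) s S \<diamondop> value_at D nw (renameFO y z \<psi>) s S"
    by (rule dia_definableE) blast
  show ?thesis
  proof (rule dia_definableI)
    show "restricted (AllFO z \<chi>)" using \<chi>(1) by (rule restricted.all)
    show "free (AllFO z \<chi>) \<subseteq> free (AllFO x \<phi>) \<union> free (AllFO y \<psi>)"
      using \<chi>(2) free_renameFO[of z \<phi> x] free_renameFO[of z \<psi> y] z by auto
    fix nw :: "'a nested_word" and s S
    show "value_at D nw (AllFO z \<chi>) s S =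
        value_at D nw (AllFO x \<phi>) s S \<diamondop> value_at D nw (AllFO y \<psi>) s S"
      using z by (simp add: \<chi>(3) value_at_renameFO Val_dia_Val)
  qed
qed

lemma dia_definable_AllFO:
  assumes "restricted \<psi>" "absorbing \<phi>"
  shows "dia_definable (AllFO x \<phi>) \<psi>"
  using assms
proof (induction arbitrary: \<phi> x rule: restricted.induct)
  \<comment> \<open>The induction leaves \<open>\<phi>\<close> and \<open>x\<close> arbitrary, so
    its hypothesis covers all of \<open>?K\<close>, as the existential cases demand.\<close>
  let ?K = "{AllFO x \<phi> | x \<phi>. absorbing \<phi>}"
  have K: "rename_closed ?K"
    by (auto simp: rename_closed_def absorbing_rename)
  {
    case (bool \<beta>)
    then show ?case
      by (intro dia_definable_boolean_or_constant)
        (auto simp: boolean_or_constant_def absorbing_def intro: restricted.all)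
  next
    case (const d)
    then show ?case
      by (intro dia_definable_boolean_or_constant)
        (auto simp: boolean_or_constant_def absorbing_def intro: restricted.all)
  next
    case (conj \<beta> \<gamma>)
    then show ?case
      by (intro dia_definable_And dia_definable_boolean_or_constant)
        (auto simp: absorbing_def intro: restricted.all)
  next
    case (disj \<psi> \<theta>)
    then show ?case by (blast intro: dia_definable_Or)
  next
    case (all \<psi> y)
    then show ?case by (intro dia_definable_AllFO_AllFO)
  next
    case (exFO \<psi> y)
    show ?case by (rule dia_definable_ExFO[OF K]) (use exFO in auto)
  next
    case (exSO \<psi> Y)
    show ?case by (rule dia_definable_ExSO[OF K]) (use exSO in auto)
  }
qed

text \<open>Only a universal quantifier cannot be handled by looking at this factor alone; there
  \<open>dia_definable_AllFO\<close> inspects the other factor.\<close>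

lemma restricted_absorbing: "restricted \<psi> \<Longrightarrow> absorbing \<psi>"
proof (induction rule: restricted.induct)
  case (bool \<beta>)
  then show ?case
    by (auto simp: absorbing_def boolean_or_constant_def
        intro: restricted.bool dia_definable_boolean_or_constant)
next
  case (const d)
  then show ?case
    by (auto simp: absorbing_def boolean_or_constant_def
        intro: restricted.const dia_definable_boolean_or_constant)
next
  case (conj \<phi> \<psi>)
  then show ?case
    by (auto simp: absorbing_def
        intro: restricted.conj dia_definable_And dia_definable_boolean_or_constant)
next
  case (disj \<phi> \<psi>)
  then show ?case by (auto simp: absorbing_def intro: restricted.disj dia_definable_Or)
next
  case (all \<psi> x)
  then show ?case
    by (auto intro: restricted.all dia_definable_commute[OF dia_definable_AllFO]
        simp: absorbing_def[of "AllFO x \<psi>"])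
next
  case (exFO \<psi> x)
  then show ?case
    using dia_definable_ExFO[OF rename_closed_restricted, of \<psi>]
    by (auto simp: absorbing_def intro: restricted.exFO)
next
  case (exSO \<psi> X)
  then show ?case
    using dia_definable_ExSO[OF rename_closed_restricted, of \<psi>]
    by (auto simp: absorbing_def intro: restricted.exSO)
qed

section \<open>From arbitrary formulas to restricted ones with the same free variables\<close>

lemma restricted_equivalent:
  "mso_formula \<phi> \<Longrightarrow> \<exists>\<chi>. restricted \<chi> \<and> free \<chi> \<subseteq> free \<phi> \<and>
    (\<forall>nw s S. value_at D nw \<chi> s S = value_at D nw \<phi> s S)"
proof (induction rule: mso_formula.induct)
  case (1 d)
  then show ?case by (intro exI[of _ "Const d"]) (auto intro: restricted.const)
next
  case (2 \<beta>)
  then show ?case by (intro exI[of _ \<beta>]) (auto intro: restricted.bool)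
next
  case (3 \<phi> \<psi>)
  then obtain \<chi> \<chi>' where "restricted \<chi>" "free \<chi> \<subseteq> free \<phi>"
    "\<forall>nw s S. value_at D nw \<chi> s S = value_at D nw \<phi> s S"
    "restricted \<chi>'" "free \<chi>' \<subseteq> free \<psi>"
    "\<forall>nw s S. value_at D nw \<chi>' s S = value_at D nw \<psi> s S"
    by blast
  then show ?case by (intro exI[of _ "Or \<chi> \<chi>'"])
      (auto simp del: split_paired_All intro: restricted.disj)
next
  case (4 \<phi> \<psi>)
  then obtain \<chi> \<chi>' where \<chi>: "restricted \<chi>" "free \<chi> \<subseteq> free \<phi>"
    "\<forall>nw s S. value_at D nw \<chi> s S = value_at D nw \<phi> s S"
    "restricted \<chi>'" "free \<chi>' \<subseteq> free \<psi>"
    "\<forall>nw s S. value_at D nw \<chi>' s S = value_at D nw \<psi> s S"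
    by blast
  \<comment> \<open>Conjunction is the one connective that can leave the restricted class, so the
    product of the two equivalents is used in its place.\<close>
  then have "dia_definable \<chi> \<chi>'"
    using restricted_absorbing unfolding absorbing_def by blast
  then obtain \<theta> where "restricted \<theta>" "free \<theta> \<subseteq> free \<chi> \<union> free \<chi>'"
    "\<And>nw s S. value_at D nw \<theta> s S = value_at D nw \<chi> s S \<diamondop> value_at D nw \<chi>' s S"
    by (rule dia_definableE) blast
  with \<chi> show ?case by (intro exI[of _ \<theta>]) auto
next
  case (5 \<phi> x)
  then obtain \<chi> where "restricted \<chi>" "free \<chi> \<subseteq> free \<phi>"
    "\<forall>nw s S. value_at D nw \<chi> s S = value_at D nw \<phi> s S"
    by blast
  then show ?case by (intro exI[of _ "AllFO x \<chi>"]) (auto intro: restricted.all)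
next
  case (6 \<phi> x)
  then obtain \<chi> where "restricted \<chi>" "free \<chi> \<subseteq> free \<phi>"
    "\<forall>nw s S. value_at D nw \<chi> s S = value_at D nw \<phi> s S"
    by blast
  then show ?case by (intro exI[of _ "ExFO x \<chi>"]) (auto intro: restricted.exFO)
next
  case (7 \<phi> X)
  then obtain \<chi> where "restricted \<chi>" "free \<chi> \<subseteq> free \<phi>"
    "\<forall>nw s S. value_at D nw \<chi> s S = value_at D nw \<phi> s S"
    by blast
  then show ?case by (intro exI[of _ "ExSO X \<chi>"]) (auto intro: restricted.exSO)
qed

text \<open>A contradiction mentioning only \<open>v\<close>. For a second order variable,
  membership also needs a position, which is then bound by a universal quantifier; every factor
  being \<open>\<zero>\<close>, so is its \<open>Val\<close>.\<close>

lemma zero_formula: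
  "\<exists>\<beta> :: ('d, 'a) mso. boolean_formula \<beta> \<and> free \<beta> = {v} \<and> (\<forall>nw s S. value_at D nw \<beta> s S = \<zero>)"
proof (cases v)
  case (FO x)
  have "boolean_formula (And (Le x x) (Neg (Le x x)))"
    by (intro boolean_formula.intros)
  then show ?thesis
    using FO by (intro exI[of _ "And (Le x x) (Neg (Le x x))"])
      (auto simp: one_dia)
next
  case (SO X)
  have "boolean_formula (AllFO 0 (And (Mem 0 X) (Neg (Mem 0 X))))"
    by (intro boolean_formula.intros)
  then show ?thesis
    using SO by (intro exI[of _ "AllFO 0 (And (Mem 0 X) (Neg (Mem 0 X)))"])
      (auto simp: one_dia zero_dia intro!: Val_zero[of _ 0])
qed

text \<open>
  The same semantics requires the same free variables; the missing ones are added by disjunction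
  with formulas of value \<open>\<zero>\<close>.
\<close>

lemma restricted_add_free:
  assumes "finite V" "restricted \<phi>"
  shows "\<exists>\<chi>. restricted \<chi> \<and> free \<chi> = free \<phi> \<union> V \<and>
    (\<forall>nw s S. value_at D nw \<chi> s S = value_at D nw \<phi> s S)"
  using assms(1)
proof induction
  case empty
  then show ?case using assms(2) by auto
next
  case (insert v V)
  then obtain \<chi> where "restricted \<chi>" "free \<chi> = free \<phi> \<union> V"
    "\<forall>nw s S. value_at D nw \<chi> s S = value_at D nw \<phi> s S"
    by blast
  moreover obtain \<beta> :: "('d, 'a) mso" where "boolean_formula \<beta>" "free \<beta> = {v}"
    "\<forall>nw s S. value_at D nw \<beta> s S = \<zero>"
    using zero_formula by blast
  ultimately show ?case
    by (intro exI[of _ "Or \<chi> \<beta>"]) (auto simp: add_zero intro: restricted.disj restricted.bool)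
qed

end

theorem corollary16:
  fixes D :: "('d, 'i index) weight_structure"
    and \<phi> :: "('d, 'a::finite) mso"
  assumes "cc_omega_valuation_semiring D"
    and "commutative D"
    and "mso_formula \<phi>"
  shows "\<exists>\<phi>' :: ('d, 'a) mso.
    mso_formula \<phi>' \<and> conjunctions_restricted \<phi>' \<and> same_semantics D \<phi> \<phi>'"
proof -
  interpret omega_pv_monoid D
    using assms(1) by (simp add: cc_omega_valuation_semiring_def)
  \<comment> \<open>Commutativity of \<open>\<diamondop>\<close> discharges the premise of
    \<open>conditionally_commutative\<close>, which yields \<open>Val_dia_Val\<close>.\<close>
  interpret commutative_cc_omega_valuation_semiring D
    using assms(1,2)
    by unfold_locales
      (auto simp: cc_omega_valuation_semiring_def commutative_def associative_def
        plus_distributive_def left_plus_distributive_def conditionally_commutative_def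
        left_distributive_def)
  obtain \<chi> where \<chi>: "restricted \<chi>" "free \<chi> \<subseteq> free \<phi>"
    "\<forall>nw s S. value_at D nw \<chi> s S = value_at D nw \<phi> s S"
    using restricted_equivalent[OF assms(3)] by blast
  obtain \<phi>' where \<phi>': "restricted \<phi>'" "free \<phi>' = free \<chi> \<union> free \<phi>"
    "\<forall>nw s S. value_at D nw \<phi>' s S = value_at D nw \<chi> s S"
    using restricted_add_free[OF finite_free \<chi>(1), of \<phi>] by blast
  have "free \<phi>' = free \<phi>"
    using \<chi>(2) \<phi>'(2) by blast
  \<comment> \<open>Equal free variables give the same valid words, so agreement of
    \<open>value_at\<close> on all nested words and assignments suffices.\<close>
  then have "same_semantics D \<phi> \<phi>'"
    using \<chi>(3) \<phi>'(3)
    by (simp add: same_semantics_def semantics_def semantics_wrt_def del: split_paired_All)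
  then show ?thesis
    using restricted_mso_formula[OF \<phi>'(1)] restricted_conjunctions_restricted[OF \<phi>'(1)] by blast
qed

end
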